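(* Let $m,n$ be an admissible pair of positive integers, i.e. $m\ge n>1$, or $(m,n)=(2,1)$, or $(m,n)=(1,1)$. Then the determinant of the adjacency matrix of the complete bridge graph $B_{m,n}$ is $$\det A(B_{m,n}) = (-1)^{m+n-1}\bigl(3-(m+n)\bigr).$$
   Context: For a simple graph $\Gamma$, $A(\Gamma)$ denotes its adjacency matrix. The complete bridge graph $B_{m,n}$ is the graph on $m+n$ vertices consisting of two vertex-disjoint complete graphs $K_m$ and $K_n$ joined by exactly one additional edge (between one vertex of $K_m$ and one vertex of $K_n$). *)

theory Defs
  imports "Graph_Theory.Graph_Theory" "Jordan_Normal_Form.Determinant"
begin

text \<open>
  A simple graph is a finite symmetric digraph without loops and multiple arcs (locale
  \<open>graph\<close>), so an edge between \<open>u\<close> and \<open>v\<close> is the pair of arcs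
  \<open>(u, v)\<close>, \<open>(v, u)\<close>.
\<close>

text \<open>
  The rows and columns of the adjacency matrix are indexed by the position of a vertex in an
  enumeration \<open>vs\<close> of the vertex set.
\<close>

definition adjacency_matrix :: "'a list \<Rightarrow> ('a, 'b) pre_digraph \<Rightarrow> 'c :: {zero, one} mat" where
  "adjacency_matrix vs G =
     mat (length vs) (length vs) (\<lambda>(i, j). if vs ! i \<rightarrow>\<^bsub>G\<^esub> vs ! j then 1 else 0)"

text \<open>
  Being the graph \<open>B\<^sub>m\<^sub>,\<^sub>n\<close> up to isomorphism, in the style of
  \<open>complete_digraph\<close>. By symmetry of \<open>G\<close> the arcs from \<open>V\<close> to
  \<open>U\<close> are the reversals of those from \<open>U\<close> to \<open>V\<close>, so the last
  conjunct says that exactly one edge joins \<open>U\<close> and \<open>V\<close>.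
\<close>

definition complete_bridge_graph :: "nat \<Rightarrow> nat \<Rightarrow> ('a, 'b) pre_digraph \<Rightarrow> bool" where
  "complete_bridge_graph m n G \<longleftrightarrow> graph G \<and>
     (\<exists>U V. verts G = U \<union> V \<and> U \<inter> V = {} \<and>
        complete_digraph m (G \<restriction> U) \<and> complete_digraph n (G \<restriction> V) \<and>
        (\<exists>u\<in>U. \<exists>v\<in>V. arcs_ends G \<inter> U \<times> V = {(u, v)}))"

lemma complete_bridge_graph_exists:
  assumes "m > 0" "n > 0"
  shows "\<exists>G :: (nat, nat \<times> nat) pre_digraph. complete_bridge_graph m n G"
proof -
  define U where "U = {0..<m}"
  define V where "V = {m..<m + n}"
  define E where "E = {(u, v). u \<noteq> v \<and> (u \<in> U \<and> v \<in> U \<or> u \<in> V \<and> v \<in> V)} \<union> {(0, m), (m, 0)}"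
  define G where "G = \<lparr>verts = U \<union> V, arcs = E, tail = fst, head = snd\<rparr>"
  have ends: "arcs_ends G = E"
    by (auto simp: arcs_ends_def arc_to_ends_def G_def)
  have mem: "0 \<in> U" "m \<in> V" "U \<inter> V = {}" "finite U" "finite V"
    using assms by (auto simp: U_def V_def)
  have "E \<subseteq> (U \<union> V) \<times> (U \<union> V)"
    using mem by (auto simp: E_def)
  then have "finite E"
    using mem by (meson finite_SigmaI finite_UnI finite_subset)
  have gr: "graph G"
  proof
    show "symmetric G"
      unfolding symmetric_def ends by (auto simp: sym_def E_def)
  qed (use mem \<open>finite E\<close> in \<open>auto simp: G_def E_def arc_to_ends_def\<close>)
  have complete: "complete_digraph (card W) (G \<restriction> W)" if W: "W = U \<or> W = V" for W
  proof -
    have *: "arcs_ends (G \<restriction> W) = {(u, v). (u, v) \<in> W \<times> W \<and> u \<noteq> v}"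
      using W mem by (auto simp: arcs_ends_def arc_to_ends_def G_def E_def image_def)
    have "graph (G \<restriction> W)"
    proof
      show "symmetric (G \<restriction> W)"
        unfolding symmetric_def * by (auto simp: sym_def)
    qed (use W mem \<open>finite E\<close> in \<open>auto simp: G_def E_def arc_to_ends_def\<close>)
    then show ?thesis
      using * by (simp add: complete_digraph_def)
  qed
  have "arcs_ends G \<inter> U \<times> V = {(0, m)}"
    unfolding ends using mem by (auto simp: E_def)
  moreover have "card U = m" "card V = n"
    by (simp_all add: U_def V_def)
  moreover have "verts G = U \<union> V"
    by (simp add: G_def)
  ultimately have "complete_bridge_graph m n G"
    unfolding complete_bridge_graph_def using gr complete[of U] complete[of V] mem by blast
  then show ?thesis by blast
qed

definition admissible_pair :: "nat \<Rightarrow> nat \<Rightarrow> bool" where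
  "admissible_pair m n \<longleftrightarrow> (m \<ge> n \<and> n > 1) \<or> (m, n) = (2, 1) \<or> (m, n) = (1, 1)"

end

theory Submission
  imports Defs
begin

text \<open>
  Adding the identity to the adjacency matrix \<open>A\<close> of \<open>B\<^sub>m\<^sub>,\<^sub>n\<close>
  leaves a matrix of rank at most four: if the bridge joins \<open>u \<in> U\<close> to
  \<open>v \<in> V\<close>, where \<open>U\<close> and \<open>V\<close> are the two cliques, then
  \<open>A + 1\<close> is the sum of the indicator matrices of the four rectangles
  \<open>U \<times> U\<close>, \<open>V \<times> V\<close>, \<open>{u} \<times> {v}\<close> and
  \<open>{v} \<times> {u}\<close>. Thus \<open>A + 1 = X\<^sup>T Y\<close>, where the four rows of
  \<open>X\<close> and of \<open>Y\<close> are the indicator vectors of the left and of the right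
  sides of these rectangles.

  Sylvester's identity \<open>det (1 - X\<^sup>T Y) = det (1 - Y X\<^sup>T)\<close>
  (\<open>det_one_minus_mult_commute\<close>) then reduces \<open>det A\<close>, up to the sign
  \<open>(-1)\<^sup>m\<^sup>+\<^sup>n\<close>, to a determinant of size four. The entries of
  \<open>Y X\<^sup>T\<close> count the elements in the intersections of right and left sides
  (\<open>indicator_mat_mult_transpose\<close>), so they do not depend on the enumeration of the
  vertices, and no reordering of rows and columns is ever needed. The value
  \<open>m + n - 3\<close> of the small determinant is found by splitting it into blocks of size two
  (\<open>det_bridge_overlaps\<close>).
\<close>

section \<open>Determinants\<close>

text \<open>
  Both sides are the determinant of \<open>\<lparr>1, B; C, 1\<rparr>\<close>: eliminating the block
  \<open>C\<close> by column operations leaves \<open>1 - B C\<close> in the upper left corner, and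
  eliminating it by row operations leaves \<open>1 - C B\<close> in the lower right corner.
\<close>

lemma det_one_minus_mult_commute:
  fixes B C :: "'a :: idom mat"
  assumes B: "B \<in> carrier_mat n k" and C: "C \<in> carrier_mat k n"
  shows "det (1\<^sub>m n - B * C) = det (1\<^sub>m k - C * B)"
proof -
  define M where "M = four_block_mat (1\<^sub>m n) B C (1\<^sub>m k)"
  define L where "L = four_block_mat (1\<^sub>m n) (0\<^sub>m n k) (- C) (1\<^sub>m k)"
  have M: "M \<in> carrier_mat (n + k) (n + k)" and L: "L \<in> carrier_mat (n + k) (n + k)"
    unfolding M_def L_def by (rule four_block_carrier_mat; simp)+
  have det_L: "det L = 1"
    unfolding L_def using C by (subst det_four_block_mat_upper_right_zero[of _ n _ k]) auto
  have "M * L = four_block_mat (1\<^sub>m n - B * C) B (0\<^sub>m k n) (1\<^sub>m k)"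
    unfolding M_def L_def using B C
    by (subst mult_four_block_mat[of _ n n _ k _ k _ _ n _ k])
       (auto intro!: cong_four_block_mat)
  then have "det (M * L) = det (1\<^sub>m n - B * C)"
    using B C by (simp, subst det_four_block_mat_lower_left_zero[of _ n _ k]) auto
  moreover have "L * M = four_block_mat (1\<^sub>m n) B (0\<^sub>m k n) (1\<^sub>m k - C * B)"
    unfolding M_def L_def using B C
    by (subst mult_four_block_mat[of _ n n _ k _ k _ _ n _ k])
       (auto intro!: cong_four_block_mat)
  then have "det (L * M) = det (1\<^sub>m k - C * B)"
    using B C by (simp, subst det_four_block_mat_lower_left_zero[of _ n _ k]) auto
  ultimately show ?thesis
    using M L det_L by (simp add: det_mult)
qed

lemma det_2x2:
  fixes A :: "'a :: comm_ring_1 mat"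
  assumes A: "A \<in> carrier_mat 2 2"
  shows "det A = A $$ (0, 0) * A $$ (1, 1) - A $$ (0, 1) * A $$ (1, 0)"
proof -
  have "det (mat_delete A i 0) = A $$ (1 - i, 1)" if "i < 2" for i
    using A that by (subst det_single) (auto simp: mat_delete_def less_2_cases_iff)
  then show ?thesis
    using A by (simp add: laplace_expansion_column[OF A, of 0] cofactor_def numeral_2_eq_2)
qed

text \<open>
  This is the size-four determinant of \<open>1 - Y X\<^sup>T\<close>, for \<open>a = |U|\<close> and \<open>b = |V|\<close>.
  In blocks of size two it is \<open>\<lparr>D, -1; -P, 1 - P\<rparr>\<close> with
  \<open>D\<close> diagonal and \<open>P\<close> the transposition matrix. The lower two blocks commute,
  so its determinant is \<open>det (D (1 - P) - P)\<close>.
\<close>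

lemma det_bridge_overlaps:
  fixes a b :: "'a :: idom"
  shows "det (mat_of_rows_list 4
      [[1 - a, 0, - 1, 0],
       [0, 1 - b, 0, - 1],
       [0, - 1, 1, - 1],
       [- 1, 0, - 1, 1]]) = a + b - 3" (is "det ?M = _")
proof -
  define D where "D = mat_of_rows_list 2 [[1 - a, 0], [0, 1 - b]]"
  define P where "P = mat_of_rows_list 2 [[0, 1], [1, 0 :: 'a]]"
  have D: "D \<in> carrier_mat 2 2" and P: "P \<in> carrier_mat 2 2"
    by (auto simp: D_def P_def mat_of_rows_list_def)
  have "?M = four_block_mat D (- 1\<^sub>m 2) (- P) (1\<^sub>m 2 - P)"
    by (rule eq_matI)
       (auto simp: D_def P_def mat_of_rows_list_def less_Suc_eq numeral_eq_Suc)
  also have "det \<dots> = det (D * (1\<^sub>m 2 - P) - (- 1\<^sub>m 2) * (- P))"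
    using D P by (intro det_four_block_mat)
      (auto simp: mult_minus_distrib_mat[OF P one_carrier_mat P]
        minus_mult_distrib_mat[OF one_carrier_mat P P])
  also have "\<dots> = a + b - 3"
    by (subst det_2x2)
       (auto simp: D_def P_def mat_of_rows_list_def scalar_prod_def numeral_2_eq_2 algebra_simps)
  finally show ?thesis .
qed

section \<open>Indicator vectors of vertex sets\<close>

definition indicator_mat :: "'v list \<Rightarrow> 'v set list \<Rightarrow> 'a :: zero_neq_one mat" where
  "indicator_mat vs Ss =
     mat (length Ss) (length vs) (\<lambda>(k, i). of_bool (vs ! i \<in> Ss ! k))"

lemma indicator_mat_carrier [simp]:
  "indicator_mat vs Ss \<in> carrier_mat (length Ss) (length vs)"
  by (simp add: indicator_mat_def)

lemma indicator_mat_mult_transpose: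
  assumes "distinct vs" and "\<And>S. S \<in> set Ss \<Longrightarrow> S \<subseteq> set vs"
  shows "indicator_mat vs Ss * (indicator_mat vs Ts)\<^sup>T =
    mat (length Ss) (length Ts) (\<lambda>(k, l). of_nat (card (Ss ! k \<inter> Ts ! l)) :: 'a :: comm_ring_1)"
    (is "?L = ?R")
proof (rule eq_matI)
  fix k l assume "k < dim_row ?R" and "l < dim_col ?R"
  then have k: "k < length Ss" and l: "l < length Ts" by auto
  then have sub: "Ss ! k \<inter> Ts ! l \<subseteq> set vs"
    using assms(2)[of "Ss ! k"] by auto
  have "?L $$ (k, l) = (\<Sum>i<length vs. of_bool (vs ! i \<in> Ss ! k \<inter> Ts ! l))"
    using k l by (auto simp: indicator_mat_def scalar_prod_def atLeast0LessThan
        Collect_conj_eq Int_assoc)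
  also have "\<dots> = (\<Sum>x\<in>set vs. of_bool (x \<in> Ss ! k \<inter> Ts ! l))"
    using assms(1) by (intro sum.reindex_bij_betw bij_betw_nth) auto
  also have "\<dots> = of_nat (card (Ss ! k \<inter> Ts ! l))"
    using sub by (auto intro!: arg_cong[where f = "\<lambda>S. of_nat (card S)"])
  finally show "?L $$ (k, l) = ?R $$ (k, l)"
    using k l by simp
qed (auto simp: indicator_mat_def)

section \<open>The bridge graph\<close>

lemma dominates_induce_subgraph_iff:
  assumes "x \<in> S" and "y \<in> S"
  shows "x \<rightarrow>\<^bsub>G \<restriction> S\<^esub> y \<longleftrightarrow> x \<rightarrow>\<^bsub>G\<^esub> y"
  using assms by (auto simp: arcs_ends_def arc_to_ends_def)

lemma complete_bridge_graphE:
  assumes "complete_bridge_graph m n G"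
  obtains U V u v where
    "verts G = U \<union> V" and "U \<inter> V = {}" and "card U = m" and "card V = n"
    and "u \<in> U" and "v \<in> V"
    and "\<And>x y. x \<in> verts G \<Longrightarrow> y \<in> verts G \<Longrightarrow> x \<rightarrow>\<^bsub>G\<^esub> y \<longleftrightarrow>
      x \<noteq> y \<and> (x \<in> U \<and> y \<in> U \<or> x \<in> V \<and> y \<in> V) \<or> x = u \<and> y = v \<or> x = v \<and> y = u"
proof -
  obtain U V u v where UV: "verts G = U \<union> V" "U \<inter> V = {}" and G: "graph G"
    and KU: "complete_digraph m (G \<restriction> U)" and KV: "complete_digraph n (G \<restriction> V)"
    and uv: "u \<in> U" "v \<in> V" and bridge: "arcs_ends G \<inter> U \<times> V = {(u, v)}"
    using assms unfolding complete_bridge_graph_def by blast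
  have clique: "x \<rightarrow>\<^bsub>G\<^esub> y \<longleftrightarrow> x \<noteq> y"
    if "x \<in> U \<and> y \<in> U \<or> x \<in> V \<and> y \<in> V" for x y
    using that
  proof
    assume "x \<in> U \<and> y \<in> U"
    then show ?thesis
      using KU dominates_induce_subgraph_iff[of x U y G] by (simp add: complete_digraph_def)
  next
    assume "x \<in> V \<and> y \<in> V"
    then show ?thesis
      using KV dominates_induce_subgraph_iff[of x V y G] by (simp add: complete_digraph_def)
  qed
  have sym: "x \<rightarrow>\<^bsub>G\<^esub> y \<longleftrightarrow> y \<rightarrow>\<^bsub>G\<^esub> x" for x y
  proof -
    interpret graph G by (fact G)
    show ?thesis using arcs_ends_symmetric[OF sym_arcs] by blast
  qed
  have cross: "x \<rightarrow>\<^bsub>G\<^esub> y \<longleftrightarrow> x = u \<and> y = v" if "x \<in> U" "y \<in> V" for x y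
    using that bridge by blast
  show thesis
  proof
    show "card U = m" "card V = n"
      using KU KV by (auto simp: complete_digraph_def)
    fix x y assume "x \<in> verts G" "y \<in> verts G"
    then consider "x \<in> U \<and> y \<in> U \<or> x \<in> V \<and> y \<in> V" | "x \<in> U" "y \<in> V" | "x \<in> V" "y \<in> U"
      using UV by auto
    then show "x \<rightarrow>\<^bsub>G\<^esub> y \<longleftrightarrow>
      x \<noteq> y \<and> (x \<in> U \<and> y \<in> U \<or> x \<in> V \<and> y \<in> V) \<or> x = u \<and> y = v \<or> x = v \<and> y = u"
    proof cases
      case 1
      then show ?thesis using clique[OF 1] UV uv by blast
    next
      case 2
      then show ?thesis using cross[OF 2] UV uv by blast
    next
      case 3
      then show ?thesis using cross[OF 3(2,1)] sym[of x y] UV uv by blast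
    qed
  qed (use UV uv in auto)
qed

theorem theorem2p1:
  fixes G :: "('a, 'b) pre_digraph" and vs :: "'a list" and m n :: nat
  assumes "admissible_pair m n"
    and "complete_bridge_graph m n G"
    and "distinct vs" and "set vs = verts G"
  shows "det (adjacency_matrix vs G) = (-1 :: int) ^ (m + n - 1) * (3 - int (m + n))"
proof -
  obtain U V u v where UV: "verts G = U \<union> V" "U \<inter> V = {}"
    and card: "card U = m" "card V = n" and uv: "u \<in> U" "v \<in> V"
    and dom: "\<And>x y. x \<in> verts G \<Longrightarrow> y \<in> verts G \<Longrightarrow> x \<rightarrow>\<^bsub>G\<^esub> y \<longleftrightarrow>
      x \<noteq> y \<and> (x \<in> U \<and> y \<in> U \<or> x \<in> V \<and> y \<in> V) \<or> x = u \<and> y = v \<or> x = v \<and> y = u"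
    by (rule complete_bridge_graphE[OF assms(2)]) blast
  have fin: "finite U" "finite V"
    using UV assms(4) by (metis List.finite_set finite_Un)+
  have len: "length vs = m + n"
    using distinct_card[OF assms(3)] assms(4) UV card_Un_disjoint[OF fin UV(2)] card by simp
  define X :: "int mat" where "X = indicator_mat vs [U, V, {u}, {v}]"
  define Y :: "int mat" where "Y = indicator_mat vs [U, V, {v}, {u}]"
  have X: "X \<in> carrier_mat 4 (m + n)" and Y: "Y \<in> carrier_mat 4 (m + n)"
    using indicator_mat_carrier[of vs "[U, V, {u}, {v}]"]
      indicator_mat_carrier[of vs "[U, V, {v}, {u}]"]
    by (simp_all add: X_def Y_def len numeral_eq_Suc)
  \<comment> \<open>The four rectangles are disjoint, and their union consists of the diagonal and the arcs.\<close>
  have rectangles: "of_bool (x \<in> U \<and> y \<in> U) + of_bool (x \<in> V \<and> y \<in> V) +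
      of_bool (x = u \<and> y = v) + of_bool (x = v \<and> y = u) =
      of_bool (x = y) + (of_bool (x \<rightarrow>\<^bsub>G\<^esub> y) :: int)"
    if x: "x \<in> verts G" and y: "y \<in> verts G" for x y
  proof -
    have "x \<in> V \<longleftrightarrow> x \<notin> U" "y \<in> V \<longleftrightarrow> y \<notin> U" "u \<in> U" "v \<notin> U"
      using x y UV uv by auto
    then show ?thesis
      unfolding dom[OF x y]
      by (cases "x = u"; cases "x = v"; cases "y = u"; cases "y = v"; cases "x = y") simp_all
  qed
  have "adjacency_matrix vs G = - 1 \<cdot>\<^sub>m (1\<^sub>m (m + n) - X\<^sup>T * Y)" (is "?A = ?B")
  proof (rule eq_matI)
    fix i j assume "i < dim_row ?B" and "j < dim_col ?B"
    then have ij: "i < m + n" "j < m + n" using X Y by auto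
    then have mem: "vs ! i \<in> verts G" "vs ! j \<in> verts G"
      using assms(4) len nth_mem by metis+
    have eq: "vs ! i = vs ! j \<longleftrightarrow> i = j"
      using ij len assms(3) by (simp add: nth_eq_iff_index_eq)
    have "(X\<^sup>T * Y) $$ (i, j) = of_bool (vs ! i \<in> U \<and> vs ! j \<in> U) +
        of_bool (vs ! i \<in> V \<and> vs ! j \<in> V) + of_bool (vs ! i = u \<and> vs ! j = v) +
        of_bool (vs ! i = v \<and> vs ! j = u)"
      using ij len
      by (simp add: X_def Y_def indicator_mat_def scalar_prod_def numeral_eq_Suc of_bool_conj)
    also have "\<dots> = of_bool (i = j) + ?A $$ (i, j)"
      unfolding rectangles[OF mem] eq using ij by (simp add: adjacency_matrix_def len)
    finally have *: "(X\<^sup>T * Y) $$ (i, j) = of_bool (i = j) + ?A $$ (i, j)" .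
    have "?B $$ (i, j) = (X\<^sup>T * Y) $$ (i, j) - of_bool (i = j)"
      using ij X Y by (simp del: index_mult_mat(1))
    then show "?A $$ (i, j) = ?B $$ (i, j)"
      using * by simp
  qed (use X Y in \<open>auto simp: adjacency_matrix_def len\<close>)
  then have "det (adjacency_matrix vs G) = (- 1) ^ (m + n) * det (1\<^sub>m (m + n) - X\<^sup>T * Y)"
    using X Y by simp
  also have "det (1\<^sub>m (m + n) - X\<^sup>T * Y) = det (1\<^sub>m 4 - Y * X\<^sup>T)"
    using X Y by (intro det_one_minus_mult_commute) auto
  also have "1\<^sub>m 4 - Y * X\<^sup>T = mat_of_rows_list 4
      [[1 - int m, 0, - 1, 0],
       [0, 1 - int n, 0, - 1],
       [0, - 1, 1, - 1],
       [- 1, 0, - 1, 1]]"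
  proof -
    have ne: "u \<notin> V" "v \<notin> U" "u \<noteq> v" "V \<inter> U = {}" using UV uv by auto
    have "Y * X\<^sup>T = mat 4 4 (\<lambda>(k, l). int (card ([U, V, {v}, {u}] ! k \<inter> [U, V, {u}, {v}] ! l)))"
      unfolding X_def Y_def using assms(3,4) UV uv
      by (subst indicator_mat_mult_transpose) (auto simp: numeral_eq_Suc)
    then show ?thesis
      using UV uv ne card
      by (intro eq_matI) (auto simp: mat_of_rows_list_def less_Suc_eq numeral_eq_Suc)
  qed
  also have "det \<dots> = int m + int n - 3"
    by (rule det_bridge_overlaps)
  also have "(- 1) ^ (m + n) * (int m + int n - 3) =
      (- 1) ^ (m + n - 1) * (3 - int (m + n))"
  proof -
    have "m + n = Suc (m + n - 1)"
      using assms(1) by (auto simp: admissible_pair_def)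
    then have "(- 1 :: int) ^ (m + n) = - ((- 1) ^ (m + n - 1))"
      by (metis mult_minus1 power_Suc)
    then show ?thesis by (simp add: algebra_simps)
  qed
  finally show ?thesis .
qed

end
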